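(* Let $N\ge 5$ be an odd integer, $\tau\in\mathbf C$ with $\operatorname{Im}\tau>0$, and let $E_{\Theta_\tau}\subset\mathbf P^{N-1}$ be the image of $\mathbf{C}/(\mathbf Z+\mathbf Z\tau)$ under $z\mapsto(\theta^{(N)}_0(z,\tau):\dots:\theta^{(N)}_{N-1}(z,\tau))$. Let $X_0,\dots,X_{N-1}$ be the coordinates of $\mathbf P^{N-1}$ (indices in $\mathbf Z/N\mathbf Z$), let $V=H^0(\mathbf P^{N-1},\mathcal I_{E_{\Theta_\tau}}(2))$ be the space of quadratic forms vanishing on $E_{\Theta_\tau}$, and let $V_k=V\cap\langle X_iX_j\mid i+j\equiv k\bmod N\rangle$. Put $a_i=\theta^{(N)}_i(0,\tau)$. Then: (1) For all $k=0,\dots,N-1$ the vector space $V_k$ is isomorphic to $V_0$, by the map $V_0\to V_k$ induced by $X_iX_j\mapsto X_{i+k/2}X_{j+k/2}$, where the indices (and $k/2$) are taken in $\mathbf Z/N\mathbf Z$. (2) The quadratic forms $$a_{j+1}a_{N-j}X_0^2-a_{\frac{N-1}2-j}\,a_{\frac{N+1}2+j}\,X_{\frac{N+1}2}X_{\frac{N-1}2}+a_{\frac{N-1}2}a_{\frac{N+1}2}\,X_{\frac{N-1}2-j}X_{\frac{N+1}2+j},\qquad j=1,\dots,\tfrac{N-3}2,$$ form a basis of the vector space $V_0$.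
   Context: With $\mathbf e(x)=e^{2\pi i x}$, for an integer $k$, $$\theta^{(N)}_k(z,\tau)=\sum_{n\in\mathbf Z}\mathbf e\Bigl(\tfrac12N\bigl(n-\tfrac kN+\tfrac12\bigr)^2\tau+N\bigl(n-\tfrac kN+\tfrac12\bigr)\bigl(z+\tfrac12\bigr)\Bigr),$$ which depends only on $k\bmod N$. The map $z\mapsto(\theta_0^{(N)}(z,\tau):\dots:\theta^{(N)}_{N-1}(z,\tau))$ embeds the elliptic curve $\mathbf C/(\mathbf Z+\mathbf Z\tau)$ as a curve of degree $N$ in $\mathbf P^{N-1}$. *)

theory Defs
  imports "HOL-Analysis.Analysis" "HOL-Library.Poly_Mapping" "HOL-Number_Theory.Cong"
begin

section \<open>Theta functions and the embedded elliptic curve\<close>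

definition ee :: "complex \<Rightarrow> complex" where
  "ee x = exp (2 * of_real pi * \<i> * x)"

definition theta :: "nat \<Rightarrow> int \<Rightarrow> complex \<Rightarrow> complex \<Rightarrow> complex" where
  "theta N k z \<tau> =
     (\<Sum>\<^sub>\<infinity>n::int.
        ee (1/2 * of_nat N * (of_int n - of_int k / of_nat N + 1/2)\<^sup>2 * \<tau>
            + of_nat N * (of_int n - of_int k / of_nat N + 1/2) * (z + 1/2)))"

text \<open>
  A point of the projective space of dimension \<open>N - 1\<close> is the set of all its
  homogeneous coordinate vectors. A vector is a function on \<open>nat\<close> that vanishes
  outside \<open>{..<N}\<close>.
\<close>

definition proj_point :: "(nat \<Rightarrow> complex) \<Rightarrow> (nat \<Rightarrow> complex) set" where
  "proj_point v = {(\<lambda>i. c * v i) | c. c \<noteq> 0}"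

definition theta_vec :: "nat \<Rightarrow> complex \<Rightarrow> complex \<Rightarrow> (nat \<Rightarrow> complex)" where
  "theta_vec N \<tau> z = (\<lambda>i. if i < N then theta N (int i) z \<tau> else 0)"

text \<open>
  The map to projective space is invariant under translation of \<open>z\<close> by the lattice
  generated by \<open>1\<close> and \<open>\<tau>\<close>, so the image of the quotient torus is the image of the
  whole complex plane.
\<close>

definition theta_curve :: "nat \<Rightarrow> complex \<Rightarrow> (nat \<Rightarrow> complex) set set" where
  "theta_curve N \<tau> = {proj_point (theta_vec N \<tau> z) | z. z \<in> UNIV}"


section \<open>Polynomials in the homogeneous coordinates\<close>

text \<open>
  Polynomials over the complex numbers in the variables \<open>X\<^sub>0, X\<^sub>1, \<dots>\<close>: finitely
  supported functions from exponent vectors to coefficients, with convolution product.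
\<close>

type_synonym cpoly = "(nat \<Rightarrow>\<^sub>0 nat) \<Rightarrow>\<^sub>0 complex"

definition X :: "nat \<Rightarrow> cpoly" where
  "X i = Poly_Mapping.single (Poly_Mapping.single i 1) 1"

definition psmult :: "complex \<Rightarrow> cpoly \<Rightarrow> cpoly" where
  "psmult c p = Poly_Mapping.single 0 c * p"

interpretation cpoly: vector_space psmult
proof
  show "psmult a (psmult b p) = psmult (a * b) p" for a b p
    by (simp add: psmult_def mult_single flip: mult.assoc)
qed (simp_all add: psmult_def distrib_left distrib_right single_add)

definition peval :: "cpoly \<Rightarrow> (nat \<Rightarrow> complex) \<Rightarrow> complex" where
  "peval p x =
     (\<Sum>m\<in>Poly_Mapping.keys p.
        Poly_Mapping.lookup p m * (\<Prod>i\<in>Poly_Mapping.keys m. x i ^ Poly_Mapping.lookup m i))"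

definition psubst :: "(nat \<Rightarrow> cpoly) \<Rightarrow> cpoly \<Rightarrow> cpoly" where
  "psubst f p =
     (\<Sum>m\<in>Poly_Mapping.keys p.
        psmult (Poly_Mapping.lookup p m)
          (\<Prod>i\<in>Poly_Mapping.keys m. f i ^ Poly_Mapping.lookup m i))"

definition quadratic_forms :: "nat \<Rightarrow> cpoly set" where
  "quadratic_forms N =
     {p. \<forall>m\<in>Poly_Mapping.keys p. Poly_Mapping.keys m \<subseteq> {..<N} \<and>
           (\<Sum>i\<in>Poly_Mapping.keys m. Poly_Mapping.lookup m i) = 2}"

definition vanishes_on :: "cpoly \<Rightarrow> (nat \<Rightarrow> complex) set set \<Rightarrow> bool" where
  "vanishes_on p S \<longleftrightarrow> (\<forall>P\<in>S. \<forall>x\<in>P. peval p x = 0)"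

definition V :: "nat \<Rightarrow> complex \<Rightarrow> cpoly set" where
  "V N \<tau> = {p \<in> quadratic_forms N. vanishes_on p (theta_curve N \<tau>)}"

definition Vk :: "nat \<Rightarrow> complex \<Rightarrow> nat \<Rightarrow> cpoly set" where
  "Vk N \<tau> k =
     V N \<tau> \<inter> cpoly.span {X i * X j | i j. i < N \<and> j < N \<and> [i + j = k] (mod N)}"

text \<open>For odd \<open>N\<close> the inverse of \<open>2\<close> modulo \<open>N\<close> is \<open>(N + 1) / 2\<close>.\<close>

definition half_mod :: "nat \<Rightarrow> nat \<Rightarrow> nat" where
  "half_mod N k = (k * ((N + 1) div 2)) mod N"

definition shift :: "nat \<Rightarrow> nat \<Rightarrow> cpoly \<Rightarrow> cpoly" where
  "shift N h = psubst (\<lambda>i. X ((i + h) mod N))"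

definition theta_null :: "nat \<Rightarrow> complex \<Rightarrow> nat \<Rightarrow> complex" where
  "theta_null N \<tau> i = theta N (int i) 0 \<tau>"

definition theta_quadric :: "nat \<Rightarrow> complex \<Rightarrow> nat \<Rightarrow> cpoly" where
  "theta_quadric N \<tau> j = (let a = theta_null N \<tau> in
       psmult (a (j + 1) * a (N - j)) ((X 0)\<^sup>2)
     - psmult (a ((N - 1) div 2 - j) * a ((N + 1) div 2 + j))
         (X ((N + 1) div 2) * X ((N - 1) div 2))
     + psmult (a ((N - 1) div 2) * a ((N + 1) div 2))
         (X ((N - 1) div 2 - j) * X ((N + 1) div 2 + j)))"


section \<open>Basic properties\<close>

lemma half_mod_cong:
  assumes "odd N"
  shows "[2 * half_mod N k = k] (mod N)"
proof -
  have "2 * (k * ((N + 1) div 2)) = k + k * N"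
    using assms by (auto elim!: oddE simp: algebra_simps)
  then have "(2 * (k * ((N + 1) div 2))) mod N = k mod N"
    by simp
  then show ?thesis
    by (metis cong_def half_mod_def mod_mult_right_eq)
qed

lemma XX_eq_single:
  "X i * X j = Poly_Mapping.single (Poly_Mapping.single i 1 + Poly_Mapping.single j 1) 1"
  by (simp add: X_def mult_single)

lemma shift_XX: "shift N h (X i * X j) = X ((i + h) mod N) * X ((j + h) mod N)"
proof (cases "i = j")
  case True
  then show ?thesis
    by (simp add: shift_def psubst_def XX_eq_single psmult_def power2_eq_square
             flip: single_add numeral_2_eq_2)
next
  case False
  then have "Poly_Mapping.keys (Poly_Mapping.single i 1 + Poly_Mapping.single j (1::nat)) = {i, j}"
    by (auto simp: in_keys_iff lookup_add lookup_single when_def split: if_splits)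
  moreover have "shift N h (X i * X j) =
      (\<Prod>n\<in>Poly_Mapping.keys (Poly_Mapping.single i 1 + Poly_Mapping.single j (1::nat)).
         X ((n + h) mod N) ^ (Poly_Mapping.lookup (Poly_Mapping.single i 1 + Poly_Mapping.single j 1) n))"
    by (simp add: shift_def psubst_def XX_eq_single psmult_def)
  ultimately show ?thesis
    using False by (simp add: lookup_add lookup_single)
qed

lemma peval_superset:
  assumes "finite A" "Poly_Mapping.keys p \<subseteq> A"
  shows "peval p x =
    (\<Sum>m\<in>A. Poly_Mapping.lookup p m * (\<Prod>i\<in>Poly_Mapping.keys m. x i ^ Poly_Mapping.lookup m i))"
  unfolding peval_def using assms by (intro sum.mono_neutral_left) (auto simp: in_keys_iff)

lemma peval_zero [simp]: "peval 0 x = 0"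
  by (simp add: peval_def)

lemma peval_add: "peval (p + q) x = peval p x + peval q x"
proof -
  let ?A = "Poly_Mapping.keys p \<union> Poly_Mapping.keys q"
  have "Poly_Mapping.keys (p + q) \<subseteq> ?A"
    by (rule Poly_Mapping.keys_add)
  then show ?thesis
    by (simp add: peval_superset [of ?A] lookup_add algebra_simps sum.distrib)
qed

lemma lookup_psmult: "Poly_Mapping.lookup (psmult c p) m = c * Poly_Mapping.lookup p m"
  by (simp add: psmult_def Poly_Mapping.map.rep_eq when_def flip: mult_map_scale_conv_mult)

lemma keys_psmult: "Poly_Mapping.keys (psmult c p) \<subseteq> Poly_Mapping.keys p"
  by (auto simp: in_keys_iff lookup_psmult)

lemma peval_psmult: "peval (psmult c p) x = c * peval p x"
  unfolding peval_superset [OF finite_keys keys_psmult]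
  by (simp add: lookup_psmult peval_def sum_distrib_left mult.assoc)

lemma subspace_V: "cpoly.subspace (V N \<tau>)"
proof (rule cpoly.subspaceI)
  show "0 \<in> V N \<tau>"
    by (simp add: V_def quadratic_forms_def vanishes_on_def)
  show "p + q \<in> V N \<tau>" if "p \<in> V N \<tau>" "q \<in> V N \<tau>" for p q
  proof -
    have "p + q \<in> quadratic_forms N"
      using that Poly_Mapping.keys_add [of p q] unfolding V_def quadratic_forms_def by blast
    then show ?thesis
      using that by (simp add: V_def vanishes_on_def peval_add)
  qed
  show "psmult c p \<in> V N \<tau>" if "p \<in> V N \<tau>" for c p
  proof -
    have "psmult c p \<in> quadratic_forms N"
      using that keys_psmult [of c p] unfolding V_def quadratic_forms_def by blast
    then show ?thesis
      using that by (simp add: V_def vanishes_on_def peval_psmult)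
  qed
qed

lemma subspace_Vk: "cpoly.subspace (Vk N \<tau> k)"
  unfolding Vk_def by (intro cpoly.subspace_inter subspace_V cpoly.subspace_span)

end

theory Submission
  imports Defs "HOL-Library.Nat_Bijection"
begin

text \<open>
  Write \<open>f\<^sub>k(z) = \<theta>\<^sub>k(z) \<theta>\<^bsub>-k\<^esub>(z)\<close>. Multiplying two theta series and changing the summation
  variables \<open>(s, t)\<close> to \<open>(s + t, s - t)\<close> shows that all \<open>f\<^sub>k\<close> are combinations, with coefficient
  vectors \<open>(A\<^sub>k, B\<^sub>k)\<close>, of the same two functions, and that \<open>A\<^sub>i B\<^sub>j - B\<^sub>i A\<^sub>j = a\<^bsub>i+j\<^esub> a\<^bsub>i-j\<^esub>\<close>. So any
  three \<open>f\<^sub>k\<close> satisfy a linear relation with these determinants as coefficients, and the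
  quadrics of the theorem are such relations. Jacobi's triple product gives \<open>a\<^sub>k \<noteq> 0\<close> for \<open>k\<close> not
  divisible by \<open>N\<close>; hence the quadrics are independent and reduce every form in \<open>V\<^sub>0\<close> to a
  combination of \<open>f\<^sub>0\<close> and \<open>f\<^bsub>(N-1)/2\<^esub>\<close>, which are independent because \<open>a\<^sub>0 = 0\<close>. The isomorphism
  \<open>V\<^sub>0 \<rightarrow> V\<^sub>k\<close> comes from translation of \<open>z\<close> by multiples of \<open>\<tau>/N\<close>, which permutes the \<open>\<theta>\<^sub>i\<close>
  cyclically up to a common factor.
\<close>

section \<open>Gaussian series and Jacobi's triple product\<close>

lemma summable_on_int_exp_abs: "(\<lambda>n::int. exp (- \<bar>of_int n\<bar> :: real)) summable_on UNIV"
proof -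
  have *: "(\<lambda>n::nat. exp (- real n)) summable_on UNIV"
  proof (rule norm_summable_imp_summable_on)
    have "summable (\<lambda>n. exp (-1 :: real) ^ n)"
      by (rule summable_geometric) simp
    then show "summable (\<lambda>n. norm (exp (- real n)))"
      by (simp flip: exp_of_nat_mult)
  qed
  have "(\<lambda>n::int. exp (- \<bar>of_int n\<bar> :: real)) summable_on range int"
    by (subst summable_on_reindex) (use * in \<open>auto simp: o_def\<close>)
  moreover have "(\<lambda>n::int. exp (- \<bar>of_int n\<bar> :: real)) summable_on range (\<lambda>n. - int n)"
    by (subst summable_on_reindex) (use * in \<open>auto simp: o_def inj_on_def\<close>)
  ultimately have "(\<lambda>n::int. exp (- \<bar>of_int n\<bar> :: real)) summable_on
                      (range int \<union> range (\<lambda>n. - int n))"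
    by (rule summable_on_union)
  moreover have "range int \<union> range (\<lambda>n. - int n) = UNIV"
    by (metis (no_types, lifting) UNIV_eq_I UnCI int_cases2 rangeI)
  ultimately show ?thesis by simp
qed

text \<open>Fubini for absolutely convergent sums. It turns a product of two theta series into a
  double series, which may then be reindexed.\<close>

lemma has_sum_Times_mult:
  fixes f :: "'a \<Rightarrow> 'c::{real_normed_field, banach}" and g :: "'b \<Rightarrow> 'c"
  assumes f: "(\<lambda>x. norm (f x)) summable_on A" and g: "(\<lambda>y. norm (g y)) summable_on B"
  shows "((\<lambda>(x, y). f x * g y) has_sum (infsum f A * infsum g B)) (A \<times> B)"
proof -
  have "(\<lambda>p. norm (case p of (x, y) \<Rightarrow> f x * g y)) summable_on A \<times> B"
  proof (rule summable_on_SigmaI)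
    show "((\<lambda>y. norm (case (x, y) of (x, y) \<Rightarrow> f x * g y)) has_sum
        norm (f x) * infsum (\<lambda>y. norm (g y)) B) B" for x
      unfolding prod.case norm_mult by (intro has_sum_cmult_right has_sum_infsum g)
    show "(\<lambda>x. norm (f x) * infsum (\<lambda>y. norm (g y)) B) summable_on A"
      using f by (rule summable_on_cmult_left)
  qed simp
  then have "(\<lambda>(x, y). f x * g y) summable_on A \<times> B"
    by (rule abs_summable_summable)
  moreover have "((\<lambda>y. (\<lambda>(x, y). f x * g y) (x, y)) has_sum f x * infsum g B) B" for x
    unfolding prod.case by (intro has_sum_cmult_right has_sum_infsum abs_summable_summable [OF g])
  moreover have "((\<lambda>x. f x * infsum g B) has_sum infsum f A * infsum g B) A"
    by (intro has_sum_cmult_left has_sum_infsum abs_summable_summable [OF f])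
  ultimately show ?thesis
    using has_sum_SigmaI [where f = "\<lambda>(x, y). f x * g y" and g = "\<lambda>x. f x * infsum g B" and A = A
        and B = "\<lambda>_. B" and S = "infsum f A * infsum g B"] by blast
qed

lemma abs_summable_on_exp_quadratic:
  fixes a b c :: complex
  assumes "Re a < 0"
  shows "(\<lambda>n::int. norm (exp (a * (of_int n)\<^sup>2 + b * of_int n + c))) summable_on UNIV"
proof (rule Infinite_Sum.abs_summable_on_comparison_test')
  \<comment> \<open>The first summand is the maximum of Re a x^2 + (|Re b| + 1) x, found by
    completing the square. The extra 1 in the linear coefficient leaves the decay -x, so exp(-|n|)
    is a majorant.\<close>
  define d where "d = (\<bar>Re b\<bar> + 1)\<^sup>2 / (4 * - Re a) + Re c"
  show "(\<lambda>n::int. exp d * exp (- \<bar>of_int n\<bar> :: real)) summable_on UNIV"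
    by (intro summable_on_cmult_right summable_on_int_exp_abs)
  fix n :: int
  define x where "x = \<bar>real_of_int n\<bar>"
  have "Re b * of_int n \<le> \<bar>Re b\<bar> * x"
    by (metis abs_ge_self abs_mult x_def)
  moreover have "Re a * x\<^sup>2 + (\<bar>Re b\<bar> + 1) * x \<le> (\<bar>Re b\<bar> + 1)\<^sup>2 / (4 * - Re a)"
  proof -
    have "0 \<le> (2 * Re a * x + (\<bar>Re b\<bar> + 1))\<^sup>2" by simp
    then have "(4 * - Re a) * (Re a * x\<^sup>2 + (\<bar>Re b\<bar> + 1) * x) \<le> (\<bar>Re b\<bar> + 1)\<^sup>2"
      by (simp add: power2_eq_square algebra_simps)
    then show ?thesis
      using assms by (subst pos_le_divide_eq) (simp_all add: mult.commute)
  qed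
  moreover have "(real_of_int n)\<^sup>2 = x\<^sup>2" by (simp add: x_def)
  ultimately have "Re a * (real_of_int n)\<^sup>2 + Re b * of_int n + Re c \<le> d - x"
    by (simp add: d_def algebra_simps)
  moreover have "Re (a * (of_int n)\<^sup>2 + b * of_int n + c)
      = Re a * (real_of_int n)\<^sup>2 + Re b * of_int n + Re c"
    by (simp add: power2_eq_square)
  ultimately show "norm (exp (a * (of_int n)\<^sup>2 + b * of_int n + c))
       \<le> exp d * exp (- \<bar>of_int n\<bar> :: real)"
    by (simp add: norm_exp_eq_Re x_def flip: exp_add)
qed

section \<open>Gaussian binomial coefficients and the finite triple product\<close>

text \<open>Gaussian binomials by their Pascal rule, which needs no division. The truncated
  difference n - k is harmless for k > n, since its factor \<open>qbinomial q n k\<close> is then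
  0.\<close>

fun qbinomial :: "'a::comm_ring_1 \<Rightarrow> nat \<Rightarrow> nat \<Rightarrow> 'a" where
  "qbinomial q n 0 = 1"
| "qbinomial q 0 (Suc k) = 0"
| "qbinomial q (Suc n) (Suc k) = qbinomial q n (Suc k) + q ^ (n - k) * qbinomial q n k"

text \<open>The q-Pochhammer symbol (q;q)_n, that is, the q-factorial without the denominators 1 -
  q.\<close>

definition qfact :: "'a::comm_ring_1 \<Rightarrow> nat \<Rightarrow> 'a" where
  "qfact q n = (\<Prod>m<n. 1 - q ^ Suc m)"

lemma qbinomial_eq_0: "n < k \<Longrightarrow> qbinomial q n k = 0"
  by (induction q n k rule: qbinomial.induct) auto

text \<open>The quotient formula, cleared of denominators. In the Pascal rule the two terms
  contribute 1 - q^(n-k) and q^(n-k) (1 - q^(k+1)), whose sum is 1 - q^(n+1).\<close>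

lemma qbinomial_qfact:
  "k \<le> n \<Longrightarrow> qbinomial q n k * qfact q k * qfact q (n - k) = qfact q n"
proof (induction q n k rule: qbinomial.induct)
  case (3 q n k)
  have IH2: "qbinomial q n k * qfact q k * qfact q (n - k) = qfact q n"
    using 3 by simp
  have IH1: "qbinomial q n (Suc k) * qfact q (Suc k) * qfact q (n - k)
      = (1 - q ^ (n - k)) * qfact q n"
  \<comment> \<open>For k = n both sides vanish: the binomial is 0, and so is 1 - q^0.\<close>
  proof (cases "k = n")
    case False
    then have "n - k = Suc (n - Suc k)" using 3 by simp
    then have "qfact q (n - k) = (1 - q ^ (n - k)) * qfact q (n - Suc k)"
      by (metis mult.commute qfact_def lessThan_Suc prod.lessThan_Suc)
    then show ?thesis
      using 3 False by (simp add: mult.assoc mult.left_commute)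
  qed (simp add: qbinomial_eq_0)
  have *: "qfact q (Suc k) = (1 - q ^ Suc k) * qfact q k" for k
    by (simp add: qfact_def)
  have "q ^ (n - k) * q ^ Suc k = q ^ Suc n"
    using 3 by (simp flip: power_add power_Suc)
  have "qbinomial q (Suc n) (Suc k) * qfact q (Suc k) * qfact q (Suc n - Suc k)
     = qbinomial q n (Suc k) * qfact q (Suc k) * qfact q (n - k)
       + q ^ (n - k) * (1 - q ^ Suc k) * (qbinomial q n k * qfact q k * qfact q (n - k))"
    by (simp add: * algebra_simps)
  also have "\<dots> = (1 - q ^ (n - k) * q ^ Suc k) * qfact q n"
    unfolding IH1 IH2 by (simp add: algebra_simps)
  also have "\<dots> = qfact q (Suc n)"
    unfolding \<open>q ^ (n - k) * q ^ Suc k = q ^ Suc n\<close> * ..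
  finally show ?case .
qed (auto simp: qfact_def)

text \<open>The q-binomial theorem for q = exp a and the variable exp b. Exponents are kept inside
  \<open>exp\<close>, so k(k-1)/2 is an ordinary complex number and later may come from a negative
  index.\<close>

lemma qbinomial_theorem_exp:
  fixes a b :: complex
  shows "(\<Prod>m<n. 1 + exp (b + of_nat m * a)) =
    (\<Sum>k\<le>n. exp (b * of_nat k + a * (of_nat k * (of_nat k - 1) / 2)) * qbinomial (exp a) n k)"
proof (induction n)
  case (Suc n)
  define t where "t k = exp (b * of_nat k + a * (of_nat k * (of_nat k - 1) / 2))" for k
  define B where "B = qbinomial (exp a)"
  \<comment> \<open>From k to k + 1 the exponent grows by b + k a, and q^(n-k) completes this to b +
    n a, the exponent in the new factor of the product.\<close>
  have t: "t (Suc k) * exp a ^ (n - k) = t k * exp (b + of_nat n * a)" if "k \<le> n" for k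
  proof -
    have "t (Suc k) * exp a ^ (n - k) = t (Suc k) * exp (of_nat (n - k) * a)"
      by (simp add: exp_of_nat_mult)
    also have "\<dots> = t k * exp (b + of_nat n * a)"
      unfolding t_def exp_add [symmetric] using that
      by (intro arg_cong [where f = exp]) (simp add: field_simps of_nat_diff)
    finally show ?thesis .
  qed
  have "(\<Sum>k\<le>Suc n. t k * B (Suc n) k) = t 0 + (\<Sum>k\<le>n. t (Suc k) * B (Suc n) (Suc k))"
    by (subst sum.atMost_Suc_shift) (simp add: B_def)
  also have "\<dots> = t 0 + (\<Sum>k\<le>n. t (Suc k) * B n (Suc k)) + (\<Sum>k\<le>n. t (Suc k) * exp a ^ (n - k) * B n k)"
    by (simp add: B_def algebra_simps sum.distrib)
  also have "t 0 + (\<Sum>k\<le>n. t (Suc k) * B n (Suc k)) = (\<Sum>k\<le>Suc n. t k * B n k)"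
    by (subst sum.atMost_Suc_shift) (simp add: B_def)
  also have "\<dots> = (\<Sum>k\<le>n. t k * B n k)"
    by (simp add: B_def qbinomial_eq_0)
  also have "(\<Sum>k\<le>n. t (Suc k) * exp a ^ (n - k) * B n k) = (\<Sum>k\<le>n. t k * B n k * exp (b + of_nat n * a))"
    by (intro sum.cong) (auto simp: t)
  also have "(\<Sum>k\<le>n. t k * B n k) + \<dots> = (1 + exp (b + of_nat n * a)) * (\<Sum>k\<le>n. t k * B n k)"
    by (simp only: distrib_right mult_1_left sum_distrib_right [symmetric] mult.commute)
  finally show ?case
    using Suc by (simp add: t_def B_def)
qed simp

text \<open>Take 2n factors of the q-binomial theorem, starting at b - n a. The lower n are turned
  around by 1 + x = x (1 + 1/x). The product of the extracted x is exp u, which also splits off the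
  sum once the index is centred at n, and cancels.\<close>

lemma finite_jacobi_triple_product:
  fixes a b :: complex
  shows "(\<Prod>m<n. (1 + exp (b + of_nat m * a)) * (1 + exp (a - b + of_nat m * a))) =
    (\<Sum>j\<in>{-int n..int n}. exp (b * of_int j + a * (of_int j * (of_int j - 1) / 2)) *
       qbinomial (exp a) (2 * n) (nat (int n + j)))"
proof -
  define b' where "b' = b - of_nat n * a"
  define u where "u = b * of_nat n - a * (of_nat n * (of_nat n + 1) / 2)"
  have *: "(\<Prod>m<n. exp (b - (of_nat m + 1) * a)) = exp (b * of_nat n - a * (of_nat n * (of_nat n + 1) / 2))" for n
  proof (induction n)
    case (Suc n)
    then show ?case
      unfolding prod.lessThan_Suc Suc exp_add [symmetric]
      by (intro arg_cong [where f = exp]) (simp add: field_simps)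
  qed simp
  have "(\<Prod>m<n. 1 + exp (b' + of_nat m * a)) = (\<Prod>m<n. 1 + exp (b' + of_nat (n - Suc m) * a))"
    by (rule prod.nat_diff_reindex [symmetric])
  also have "\<dots> = (\<Prod>m<n. exp (b - (of_nat m + 1) * a) * (1 + exp (a - b + of_nat m * a)))"
  proof (rule prod.cong [OF refl])
    fix m assume "m \<in> {..<n}"
    then have "b' + of_nat (n - Suc m) * a = b - (of_nat m + 1) * a"
      by (simp add: b'_def of_nat_diff algebra_simps)
    moreover have "exp (b - (of_nat m + 1) * a) * exp (a - b + of_nat m * a) = 1"
      by (simp add: algebra_simps flip: exp_add)
    ultimately show "1 + exp (b' + of_nat (n - Suc m) * a)
        = exp (b - (of_nat m + 1) * a) * (1 + exp (a - b + of_nat m * a))"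
      by (simp add: distrib_left)
  qed
  finally have lower: "(\<Prod>m<n. 1 + exp (b' + of_nat m * a)) = exp u * (\<Prod>m<n. 1 + exp (a - b + of_nat m * a))"
    by (simp add: prod.distrib * u_def)
  have "(\<Prod>m<2*n. 1 + exp (b' + of_nat m * a)) =
      (\<Prod>m<n. 1 + exp (b' + of_nat m * a)) * (\<Prod>m=n..<2*n. 1 + exp (b' + of_nat m * a))"
    by (simp add: prod.atLeastLessThan_concat flip: atLeast0LessThan)
  also have "(\<Prod>m=n..<2*n. 1 + exp (b' + of_nat m * a)) = (\<Prod>m<n. 1 + exp (b + of_nat m * a))"
    by (subst prod.atLeastLessThan_shift_0) (simp add: b'_def algebra_simps atLeast0LessThan)
  finally have "exp u * (\<Prod>m<n. (1 + exp (b + of_nat m * a)) * (1 + exp (a - b + of_nat m * a))) =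
      (\<Sum>k\<le>2*n. exp (b' * of_nat k + a * (of_nat k * (of_nat k - 1) / 2)) * qbinomial (exp a) (2 * n) k)"
    unfolding qbinomial_theorem_exp [symmetric] lower prod.distrib by (simp only: mult_ac)
  also have "\<dots> = (\<Sum>j\<in>{-int n..int n}. exp u * (exp (b * of_int j + a * (of_int j * (of_int j - 1) / 2)) *
       qbinomial (exp a) (2 * n) (nat (int n + j))))"
  proof (rule sum.reindex_bij_witness [of _ "\<lambda>j. nat (int n + j)" "\<lambda>k. int k - int n"])
    fix k assume "k \<in> {..2 * n}"
    define j where "j = int k - int n"
    have k: "of_nat k = (of_nat n + of_int j :: complex)"
      by (simp add: j_def)
    have "exp (b' * of_nat k + a * (of_nat k * (of_nat k - 1) / 2))
        = exp u * exp (b * of_int j + a * (of_int j * (of_int j - 1) / 2))"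
      unfolding k exp_add [symmetric] u_def b'_def
      by (intro arg_cong [where f = exp]) (simp add: field_simps)
    then show "exp u * (exp (b * of_int (int k - int n) + a * (of_int (int k - int n) * (of_int (int k - int n) - 1) / 2)) *
        qbinomial (exp a) (2 * n) (nat (int n + (int k - int n)))) =
      exp (b' * of_nat k + a * (of_nat k * (of_nat k - 1) / 2)) * qbinomial (exp a) (2 * n) k"
      by (simp add: j_def)
  qed auto
  finally show ?thesis
    by (simp flip: sum_distrib_left)
qed

section \<open>Passage to the limit in the triple product\<close>

lemma convergent_prod_one_minus_power:
  fixes q :: complex
  assumes "norm q < 1"
  shows "convergent_prod (\<lambda>m. 1 - q ^ Suc m)"
proof (rule abs_convergent_prod_imp_convergent_prod)
  have "summable (\<lambda>m. norm q ^ Suc m)"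
    using assms by (subst summable_Suc_iff) (auto intro: summable_geometric)
  then show "abs_convergent_prod (\<lambda>m. 1 - q ^ Suc m)"
    by (subst abs_convergent_prod_conv_summable) (simp add: norm_power norm_mult)
qed

lemma convergent_prod_one_plus_exp:
  fixes a b :: complex
  assumes "Re a < 0"
  shows "convergent_prod (\<lambda>m. 1 + exp (b + of_nat m * a))"
proof (rule abs_convergent_prod_imp_convergent_prod)
  have "summable (\<lambda>m. norm (exp b) * norm (exp a) ^ m)"
    using assms by (intro summable_mult summable_geometric) (auto simp: norm_exp_eq_Re)
  then show "abs_convergent_prod (\<lambda>m. 1 + exp (b + of_nat m * a))"
    by (subst abs_convergent_prod_conv_summable) (simp add: norm_power norm_mult exp_add exp_of_nat_mult)
qed

text \<open>In the finite identity the coefficients, Gaussian binomials of 2n over n + j, are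
  bounded uniformly and tend to 1/L, where L is the infinite product of the 1 - q^m. Tannery's
  theorem then permits the limit term by term.\<close>

lemma jacobi_triple_product:
  fixes a b :: complex
  assumes "Re a < 0"
  defines "q \<equiv> exp a"
  shows "(\<lambda>n. \<Prod>m<n. (1 + exp (b + of_nat m * a)) * (1 + exp (a - b + of_nat m * a)))
    \<longlonglongrightarrow> (\<Sum>\<^sub>\<infinity>j::int. exp (b * of_int j + a * (of_int j * (of_int j - 1) / 2)))
        / prodinf (\<lambda>m. 1 - q ^ Suc m)"
proof -
  define T where "T j = exp (b * of_int j + a * (of_int j * (of_int j - 1) / 2))" for j :: int
  define Q where "Q = qfact q"
  define L where "L = prodinf (\<lambda>m. 1 - q ^ Suc m)"
  have q: "norm q < 1"
    using assms by (simp add: norm_exp_eq_Re)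
  have q1: "1 - q ^ Suc m \<noteq> 0" for m
  proof -
    have "norm (q ^ Suc m) < 1"
      using q power_Suc_le_self [of "norm q" m] by (simp add: norm_power norm_mult)
    then show ?thesis by auto
  qed
  have Q0: "Q n \<noteq> 0" for n
    using q1 unfolding Q_def qfact_def by (subst prod_zero_iff) auto
  have "Q \<longlonglongrightarrow> L"
    unfolding Q_def qfact_def L_def
    using convergent_prod_one_minus_power [OF q] by (simp add: convergent_prod_LIMSEQ LIMSEQ_lessThan_iff_atMost [of "\<lambda>A. prod _ A"])
  have "L \<noteq> 0"
    unfolding L_def using convergent_prod_one_minus_power [OF q] q1
    by (intro prodinf_nonzero) auto
  \<comment> \<open>Extending the coefficients by 0 beyond |j| = n makes every finite sum a sum over
    all integers, as dominated convergence requires.\<close>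
  define c where "c n j = (if \<bar>j\<bar> \<le> int n then qbinomial q (2 * n) (nat (int n + j)) else 0)" for n j
  have c: "c n j = Q (2 * n) * inverse (Q (nat (int n + j))) * inverse (Q (nat (int n - j)))"
    if "\<bar>j\<bar> \<le> int n" for n j
  proof -
    have "2 * n - nat (int n + j) = nat (int n - j)" using that by auto
    moreover have "nat (int n + j) \<le> 2 * n" using that by auto
    ultimately have "qbinomial q (2 * n) (nat (int n + j)) * Q (nat (int n + j)) * Q (nat (int n - j)) = Q (2 * n)"
      using qbinomial_qfact [of "nat (int n + j)" "2 * n" q] by (simp add: Q_def)
    then have "c n j * Q (nat (int n + j)) * Q (nat (int n - j)) = Q (2 * n)"
      using that by (simp add: c_def)
    then show ?thesis
      using Q0 [of "nat (int n + j)"] Q0 [of "nat (int n - j)"] by (simp add: divide_simps mult.assoc)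
  qed
  have "Bseq Q"
    using \<open>Q \<longlonglongrightarrow> L\<close> convergentI convergent_imp_Bseq by blast
  then obtain B where B: "B > 0" "\<And>n. norm (Q n) \<le> B"
    by (auto elim: BseqE)
  have "(\<lambda>n. inverse (Q n)) \<longlonglongrightarrow> inverse L"
    by (intro tendsto_inverse \<open>Q \<longlonglongrightarrow> L\<close> \<open>L \<noteq> 0\<close>)
  then have "Bseq (\<lambda>n. inverse (Q n))"
    using convergentI convergent_imp_Bseq by blast
  then obtain B' where B': "B' > 0" "\<And>n. norm (inverse (Q n)) \<le> B'"
    by (auto elim: BseqE)
  have c_bound: "norm (c n j) \<le> B * B' * B'" for n j
  proof (cases "\<bar>j\<bar> \<le> int n")
    case True
    show ?thesis
      unfolding c [OF True] norm_mult using B B' by (intro mult_mono) auto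
  qed (use B B' in \<open>auto simp: c_def\<close>)
  have c_lim: "(\<lambda>n. c n j) \<longlonglongrightarrow> 1 / L" for j
  proof -
    have nat_lim: "filterlim (\<lambda>n. nat (int n + i)) sequentially sequentially" for i
      unfolding filterlim_at_top
    proof
      fix Z
      show "\<forall>\<^sub>F x in sequentially. Z \<le> nat (int x + i)"
        using eventually_ge_at_top [of "nat (int Z - i)"] by eventually_elim auto
    qed
    have "(\<lambda>n. Q (2 * n) * inverse (Q (nat (int n + j))) * inverse (Q (nat (int n + (- j)))))
        \<longlonglongrightarrow> L * inverse L * inverse L"
      by (intro tendsto_mult tendsto_inverse \<open>L \<noteq> 0\<close> filterlim_compose [OF \<open>Q \<longlonglongrightarrow> L\<close>] nat_lim
            filterlim_subseq) (auto simp: strict_mono_def)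
    moreover have "L * inverse L * inverse L = 1 / L"
      using \<open>L \<noteq> 0\<close> by (simp add: field_simps)
    moreover have "\<forall>\<^sub>F n in sequentially. Q (2 * n) * inverse (Q (nat (int n + j))) * inverse (Q (nat (int n + (- j)))) = c n j"
      using eventually_ge_at_top [of "nat \<bar>j\<bar>"] by eventually_elim (simp add: c)
    ultimately show ?thesis
      using Lim_transform_eventually by fastforce
  qed
  have "(\<lambda>j. norm (T j)) summable_on UNIV"
    using abs_summable_on_exp_quadratic [of "a / 2" "b - a / 2" 0] assms
    by (simp add: T_def field_simps power2_eq_square)
  \<comment> \<open>Tannery's theorem concerns series over the naturals, so the integers are
    enumerated by \<open>int_decode\<close>.\<close>
  then have "(\<lambda>k. norm (T (int_decode k))) summable_on UNIV"
    using summable_on_reindex_bij_betw [OF bij_int_decode, of "\<lambda>j. norm (T j)"] by simp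
  then have sT: "summable (\<lambda>k. norm (T (int_decode k)))"
    by (rule summable_on_imp_summable)
  have "((\<lambda>n. suminf (\<lambda>k. T (int_decode k) * c n (int_decode k))) \<longlongrightarrow> suminf (\<lambda>k. T (int_decode k) * (1 / L))) sequentially"
  proof (rule tannerys_theorem [THEN conjunct2, THEN conjunct2])
    show "summable (\<lambda>k. norm (T (int_decode k)) * (B * B' * B'))"
      using sT by (rule summable_mult2)
    show "\<forall>\<^sub>F (k, n) in at_top \<times>\<^sub>F sequentially. norm (T (int_decode k) * c n (int_decode k))
        \<le> norm (T (int_decode k)) * (B * B' * B')"
      by (intro always_eventually) (auto simp: norm_mult intro!: mult_left_mono c_bound)
    show "(\<lambda>n. T (int_decode k) * c n (int_decode k)) \<longlonglongrightarrow> T (int_decode k) * (1 / L)" for k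
      by (intro tendsto_intros c_lim)
  qed simp
  moreover have "suminf (\<lambda>k. T (int_decode k) * c n (int_decode k)) =
      (\<Prod>m<n. (1 + exp (b + of_nat m * a)) * (1 + exp (a - b + of_nat m * a)))" for n
  proof -
    have "suminf (\<lambda>k. T (int_decode k) * c n (int_decode k)) =
        (\<Sum>k\<in>int_encode ` {-int n..int n}. T (int_decode k) * c n (int_decode k))"
    proof (rule suminf_finite)
      fix k assume "k \<notin> int_encode ` {-int n..int n}"
      then have "int_decode k \<notin> {-int n..int n}"
        by (metis image_eqI int_decode_inverse)
      then show "T (int_decode k) * c n (int_decode k) = 0"
        by (auto simp: c_def)
    qed simp
    also have "\<dots> = (\<Sum>j\<in>{-int n..int n}. T j * c n j)"
      by (subst sum.reindex) (auto intro: inj_int_encode)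
    also have "\<dots> = (\<Sum>j\<in>{-int n..int n}. T j * qbinomial q (2 * n) (nat (int n + j)))"
      by (intro sum.cong) (auto simp: c_def)
    finally show ?thesis
      unfolding finite_jacobi_triple_product T_def q_def .
  qed
  moreover have "suminf (\<lambda>k. T (int_decode k) * (1 / L)) = infsum T UNIV / L"
  proof -
    have "suminf (\<lambda>k. T (int_decode k)) = infsum (\<lambda>k. T (int_decode k)) UNIV"
      by (metis norm_summable_imp_has_sum sT summable_norm_cancel summable_sums infsumI)
    also have "\<dots> = infsum T UNIV"
      by (rule infsum_reindex_bij_betw [OF bij_int_decode])
    finally show ?thesis
      using suminf_divide [OF summable_norm_cancel [OF sT], of L] by simp
  qed
  ultimately show ?thesis
    by (simp only: T_def [abs_def] L_def)
qed

text \<open>With b and a - b in the left half-plane, all exponentials in the product have modulus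
  below 1. So no factor vanishes, and neither do the convergent infinite products.\<close>

lemma jacobi_theta_series_nonzero:
  fixes a b :: complex
  assumes "Re b < 0" "Re (a - b) < 0"
  shows "(\<Sum>\<^sub>\<infinity>j::int. exp (b * of_int j + a * (of_int j * (of_int j - 1) / 2))) \<noteq> 0"
proof -
  have a: "Re a < 0" using assms by simp
  have nz: "1 + exp (x + of_nat m * a) \<noteq> 0" if "Re x < 0" for x m
  proof
    assume "1 + exp (x + of_nat m * a) = 0"
    then have "norm (exp (x + of_nat m * a)) = 1"
      by (metis add_eq_0_iff norm_minus_cancel norm_one)
    moreover have "real m * Re a \<le> 0"
      using a by (simp add: mult_nonneg_nonpos)
    ultimately show False
      using that by (simp add: norm_exp_eq_Re)
  qed
  have lim: "(\<lambda>n. \<Prod>m<n. 1 + exp (x + of_nat m * a)) \<longlonglongrightarrow> prodinf (\<lambda>m. 1 + exp (x + of_nat m * a))" for x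
    using convergent_prod_one_plus_exp [OF a] by (simp add: convergent_prod_LIMSEQ LIMSEQ_lessThan_iff_atMost [of "\<lambda>A. prod _ A"])
  have nz': "prodinf (\<lambda>m. 1 + exp (x + of_nat m * a)) \<noteq> 0" if "Re x < 0" for x
    using convergent_prod_one_plus_exp [OF a] nz [OF that] by (intro prodinf_nonzero)
  have "(\<lambda>n. \<Prod>m<n. (1 + exp (b + of_nat m * a)) * (1 + exp (a - b + of_nat m * a)))
     \<longlonglongrightarrow> prodinf (\<lambda>m. 1 + exp (b + of_nat m * a)) * prodinf (\<lambda>m. 1 + exp (a - b + of_nat m * a))"
    unfolding prod.distrib by (intro tendsto_mult lim)
  from LIMSEQ_unique [OF this jacobi_triple_product [OF a]]
  have *: "prodinf (\<lambda>m. 1 + exp (b + of_nat m * a)) * prodinf (\<lambda>m. 1 + exp (a - b + of_nat m * a))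
    = (\<Sum>\<^sub>\<infinity>j::int. exp (b * of_int j + a * (of_int j * (of_int j - 1) / 2)))
        / prodinf (\<lambda>m. 1 - exp a ^ Suc m)" .
  show ?thesis
  proof
    assume "(\<Sum>\<^sub>\<infinity>j::int. exp (b * of_int j + a * (of_int j * (of_int j - 1) / 2))) = 0"
    with * have "prodinf (\<lambda>m. 1 + exp (b + of_nat m * a)) * prodinf (\<lambda>m. 1 + exp (a - b + of_nat m * a)) = 0"
      by (simp only: div_0)
    then show False
      using nz' [OF assms(1)] nz' [OF assms(2)] unfolding mult_eq_0_iff by blast
  qed
qed

section \<open>Theta functions\<close>

lemma ee_add: "ee (x + y) = ee x * ee y"
  by (simp add: ee_def distrib_left exp_add)

lemma ee_of_int [simp]: "ee (of_int n) = 1"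
  using exp_integer_2pi [of "of_int n"] by (simp add: ee_def mult_ac)

lemma ee_nonzero [simp]: "ee x \<noteq> 0"
  by (simp add: ee_def)

lemma ee_0 [simp]: "ee 0 = 1"
  by (simp add: ee_def)

lemma ee_add_of_int [simp]: "ee (x + of_int n) = ee x"
  by (simp add: ee_add)

lemma ee_half_odd:
  assumes "odd n"
  shows "ee (of_int n / 2) = -1"
proof -
  obtain m where "n = 2 * m + 1" using assms by (elim oddE)
  then have "ee (of_int n / 2) = ee (1/2 + of_int m)"
    by (intro arg_cong [where f = ee]) (simp add: field_simps)
  also have "\<dots> = -1"
    unfolding ee_add_of_int by (simp add: ee_def)
  finally show ?thesis .
qed

lemma abs_summable_on_ee_quadratic:
  assumes "Im a > 0"
  shows "(\<lambda>n::int. norm (ee (a * (of_int n)\<^sup>2 + b * of_int n + c))) summable_on UNIV"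
  using abs_summable_on_exp_quadratic [of "2 * of_real pi * \<i> * a" "2 * of_real pi * \<i> * b" "2 * of_real pi * \<i> * c"] assms
  by (simp add: ee_def algebra_simps)

lemma theta_abs_summable:
  assumes "N > 0" "Im \<tau> > 0"
  shows "(\<lambda>n::int. norm (ee (1/2 * of_nat N * (of_int n - of_int k / of_nat N + 1/2)\<^sup>2 * \<tau>
            + of_nat N * (of_int n - of_int k / of_nat N + 1/2) * (z + 1/2)))) summable_on UNIV"
proof -
  define c :: complex where "c = 1/2 - of_int k / of_nat N"
  have "1/2 * of_nat N * (of_int n - of_int k / of_nat N + 1/2)\<^sup>2 * \<tau>
            + of_nat N * (of_int n - of_int k / of_nat N + 1/2) * (z + 1/2)
     = (of_nat N * \<tau> / 2) * (of_int n)\<^sup>2 + (of_nat N * \<tau> * c + of_nat N * (z + 1/2)) * of_int n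
        + (of_nat N * \<tau> * c\<^sup>2 / 2 + of_nat N * c * (z + 1/2))" for n
  proof -
    have *: "of_int n - of_int k / of_nat N + 1/2 = of_int n + c" by (simp add: c_def)
    show ?thesis unfolding * by (simp add: algebra_simps power2_eq_square)
  qed
  then show ?thesis
    using abs_summable_on_ee_quadratic [of "of_nat N * \<tau> / 2"] assms by simp
qed

lemma theta_periodic:
  assumes "N > 0"
  shows "theta N (k + m * int N) z \<tau> = theta N k z \<tau>"
proof -
  define p :: "int \<Rightarrow> int \<Rightarrow> complex" where "p k n = of_int n - of_int k / of_nat N + 1/2" for k n
  have "bij (\<lambda>n::int. n + m)"
    by (rule bij_betw_byWitness [of _ "\<lambda>n. n - m"]) auto
  then have "theta N (k + m * int N) z \<tau> = (\<Sum>\<^sub>\<infinity>n. ee (1/2 * of_nat N * (p (k + m * int N) (n + m))\<^sup>2 * \<tau>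
      + of_nat N * p (k + m * int N) (n + m) * (z + 1/2)))"
    unfolding theta_def p_def by (subst infsum_reindex_bij_betw [symmetric, of "\<lambda>n. n + m"]) auto
  moreover have "p (k + m * int N) (n + m) = p k n" for n
    using assms by (simp add: p_def field_simps)
  ultimately show ?thesis
    by (simp only: theta_def p_def [symmetric])
qed

lemma theta_cong: "N > 0 \<Longrightarrow> [k = k'] (mod int N) \<Longrightarrow> theta N k z \<tau> = theta N k' z \<tau>"
  by (metis cong_iff_lin mult.commute theta_periodic)

text \<open>Substituting -1 - n for n negates p = n - k/N + 1/2. As -z + 1/2 differs from -(z + 1/2)
  by 1, a factor e(-Np) remains; N being odd, Np is half an odd integer, whence the sign.\<close>

lemma theta_uminus:
  assumes "odd N"
  shows "theta N (- k) (- z) \<tau> = - theta N k z \<tau>"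
proof -
  have "N > 0" using assms by (auto intro: Nat.gr0I)
  define p :: "int \<Rightarrow> int \<Rightarrow> complex" where "p k n = of_int n - of_int k / of_nat N + 1/2" for k n
  have "bij (\<lambda>n::int. - 1 - n)"
    by (rule bij_betw_byWitness [of _ "\<lambda>n. - 1 - n"]) auto
  then have "theta N (- k) (- z) \<tau> =
      (\<Sum>\<^sub>\<infinity>n. ee (1/2 * of_nat N * (p (- k) (- 1 - n))\<^sup>2 * \<tau> + of_nat N * p (- k) (- 1 - n) * (- z + 1/2)))"
    unfolding theta_def p_def by (subst infsum_reindex_bij_betw [symmetric, of "\<lambda>n. - 1 - n"]) auto
  also have "\<dots> = (\<Sum>\<^sub>\<infinity>n. - ee (1/2 * of_nat N * (p k n)\<^sup>2 * \<tau> + of_nat N * p k n * (z + 1/2)))"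
  proof (rule infsum_cong)
    fix n
    have p: "p (- k) (- 1 - n) = - p k n" by (simp add: p_def)
    have "odd (2 * k - 2 * int N * n - int N)" using assms by simp
    from ee_half_odd [OF this] have "ee (of_int (2 * k - 2 * int N * n - int N) / 2) = -1" .
    moreover have "- (of_nat N * p k n) = of_int (2 * k - 2 * int N * n - int N) / 2"
      using \<open>N > 0\<close> by (simp add: p_def field_simps)
    ultimately have *: "ee (- (of_nat N * p k n)) = -1"
      by (simp only:)
    have "1/2 * of_nat N * (p (- k) (- 1 - n))\<^sup>2 * \<tau> + of_nat N * p (- k) (- 1 - n) * (- z + 1/2)
      = (1/2 * of_nat N * (p k n)\<^sup>2 * \<tau> + of_nat N * p k n * (z + 1/2)) + - (of_nat N * p k n)"
      unfolding p by (simp add: field_simps)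
    then show "ee (1/2 * of_nat N * (p (- k) (- 1 - n))\<^sup>2 * \<tau> + of_nat N * p (- k) (- 1 - n) * (- z + 1/2))
      = - ee (1/2 * of_nat N * (p k n)\<^sup>2 * \<tau> + of_nat N * p k n * (z + 1/2))"
      by (simp only: ee_add *) simp
  qed
  also have "\<dots> = - theta N k z \<tau>"
    by (simp add: theta_def p_def infsum_uminus)
  finally show ?thesis .
qed

text \<open>Replacing p by p - h/N and expanding the square moves z by -h\<tau>/N. The factor in
  front does not depend on k, so projectively this translation permutes the coordinates
  cyclically.\<close>

lemma theta_translate:
  assumes "N > 0"
  shows "theta N (k + h) z \<tau> =
    ee ((of_int h)\<^sup>2 * \<tau> / (2 * of_nat N) - of_int h * (z + 1/2)) * theta N k (z - of_int h * \<tau> / of_nat N) \<tau>"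
proof -
  have "1/2 * of_nat N * (of_int n - of_int (k + h) / of_nat N + 1/2)\<^sup>2 * \<tau>
            + of_nat N * (of_int n - of_int (k + h) / of_nat N + 1/2) * (z + 1/2)
     = ((of_int h)\<^sup>2 * \<tau> / (2 * of_nat N) - of_int h * (z + 1/2)) +
       (1/2 * of_nat N * (of_int n - of_int k / of_nat N + 1/2)\<^sup>2 * \<tau>
            + of_nat N * (of_int n - of_int k / of_nat N + 1/2) * ((z - of_int h * \<tau> / of_nat N) + 1/2))" for n :: int
  proof -
    define p :: complex where "p = of_int n - of_int k / of_nat N + 1/2"
    have p: "of_int n - of_int (k + h) / of_nat N + 1/2 = p - of_int h / of_nat N"
      by (simp add: p_def add_divide_distrib)
    show ?thesis
      unfolding p unfolding p_def [symmetric] using assms by (simp add: field_simps power2_eq_square)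
  qed
  then show ?thesis
    unfolding theta_def by (simp only: ee_add) (rule infsum_cmult_right')
qed

text \<open>Up to an exponential, the value is a triple product series whose parameters b and a - b
  have real parts -2 pi (N - r) Im \<tau> and -2 pi r Im \<tau>, for r the residue of k. Both are
  negative because 0 < r < N.\<close>

lemma theta_zero_nonzero:
  assumes "Im \<tau> > 0" "\<not> int N dvd k" "N > 0"
  shows "theta N k 0 \<tau> \<noteq> 0"
proof -
  define r where "r = k mod int N"
  have "0 \<le> r" "r \<noteq> 0" "r < int N"
    using assms by (auto simp: r_def)
  then have r: "0 < r" "r < int N" by auto
  define c :: complex where "c = 1/2 - of_int r / of_nat N"
  define a where "a = 2 * of_real pi * \<i> * (of_nat N * \<tau>)"
  \<comment> \<open>The summand a/2 compensates for n(n-1)/2 standing in place of n^2/2.\<close>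
  define b where "b = a / 2 + 2 * of_real pi * \<i> * (of_nat N * \<tau> * c + of_nat N / 2)"
  define d where "d = of_nat N * \<tau> * c\<^sup>2 / 2 + of_nat N * c / 2"
  have "theta N k 0 \<tau> = theta N r 0 \<tau>"
    using assms by (intro theta_cong) (auto simp: r_def cong_def)
  also have "\<dots> = (\<Sum>\<^sub>\<infinity>j::int. ee d * exp (b * of_int j + a * (of_int j * (of_int j - 1) / 2)))"
    unfolding theta_def
  proof (rule infsum_cong)
    fix n :: int
    have *: "of_int n - of_int r / of_nat N + 1/2 = of_int n + c" by (simp add: c_def)
    show "ee (1/2 * of_nat N * (of_int n - of_int r / of_nat N + 1/2)\<^sup>2 * \<tau>
            + of_nat N * (of_int n - of_int r / of_nat N + 1/2) * (0 + 1/2)) =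
        ee d * exp (b * of_int n + a * (of_int n * (of_int n - 1) / 2))"
      unfolding * unfolding ee_def exp_add [symmetric]
      by (intro arg_cong [where f = exp]) (simp add: a_def b_def d_def field_simps power2_eq_square)
  qed
  also have "\<dots> = ee d * (\<Sum>\<^sub>\<infinity>j::int. exp (b * of_int j + a * (of_int j * (of_int j - 1) / 2)))"
    by (rule infsum_cmult_right')
  also have "\<dots> \<noteq> 0"
  proof -
    have Ntc: "of_nat N * \<tau> * c = of_nat N * \<tau> / 2 - of_int r * \<tau>"
      using assms by (simp add: c_def field_simps)
    have "Re b = - (2 * pi * ((real N - real_of_int r) * Im \<tau>))"
      unfolding b_def Ntc by (simp add: a_def field_simps)
    moreover have "Re (a - b) = - (2 * pi * (real_of_int r * Im \<tau>))"
      unfolding b_def Ntc by (simp add: a_def field_simps)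
    ultimately have "Re b < 0" "Re (a - b) < 0"
      using r assms by simp_all
    then show ?thesis
      using jacobi_theta_series_nonzero by simp
  qed
  finally show ?thesis .
qed

text \<open>
  With \<open>n, m\<close> the indices of two theta series, the general term of their product is a product of
  Gaussians in \<open>n + m + 1\<close> and \<open>n - m\<close>. These numbers have opposite parities, hence the two terms
  in \<open>theta_mult_theta\<close>.
\<close>

definition theta_res :: "nat \<Rightarrow> complex \<Rightarrow> int \<Rightarrow> complex \<Rightarrow> complex" where
  "theta_res N \<tau> r x = (\<Sum>\<^sub>\<infinity>n::int. ee ((of_int (2 * int N * n + r))\<^sup>2 * \<tau> / (4 * of_nat N) + of_int (2 * int N * n + r) * x))"

lemma theta_res_abs_summable:
  assumes "N > 0" "Im \<tau> > 0"
  shows "(\<lambda>n::int. norm (ee ((of_int (2 * int N * n + r))\<^sup>2 * \<tau> / (4 * of_nat N) + of_int (2 * int N * n + r) * x))) summable_on UNIV"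
proof -
  have "(of_int (2 * int N * n + r))\<^sup>2 * \<tau> / (4 * of_nat N) + of_int (2 * int N * n + r) * x
    = of_nat N * \<tau> * (of_int n)\<^sup>2 + (of_int r * \<tau> + 2 * of_nat N * x) * of_int n
      + ((of_int r)\<^sup>2 * \<tau> / (4 * of_nat N) + of_int r * x)" for n
    using assms by (simp add: field_simps power2_eq_square)
  then show ?thesis
    using abs_summable_on_ee_quadratic [of "of_nat N * \<tau>"] assms by simp
qed

text \<open>At z = w = 0 the product formula below has the argument 1/2 in one factor. The parity of
  the summation index brings it back to 0, here without and in the next lemma with a sign; this sign
  makes the thetanull products determinants.\<close>

lemma theta_res_half: "theta_res N \<tau> (2 * r) (1/2) = theta_res N \<tau> (2 * r) 0"
proof -
  have "of_int (2 * int N * n + 2 * r) * (1/2 :: complex) = of_int (int N * n + r)" for n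
    by simp
  then show ?thesis
    unfolding theta_res_def by (simp only: ee_add_of_int) simp
qed

lemma theta_res_half_odd:
  assumes "odd r"
  shows "theta_res N \<tau> r (1/2) = - theta_res N \<tau> r 0"
proof -
  have "ee (of_int (2 * int N * n + r) * (1/2)) = -1" for n
    using ee_half_odd [of "2 * int N * n + r"] assms by simp
  then show ?thesis
    unfolding theta_res_def by (simp only: ee_add) (simp add: infsum_uminus)
qed

lemma theta_mult_theta:
  assumes "N > 0" "Im \<tau> > 0"
  shows "theta N (i + j) z \<tau> * theta N (i - j) w \<tau> =
      theta_res N \<tau> (- 2 * i) ((z + w + 1) / 2) * theta_res N \<tau> (int N - 2 * j) ((z - w) / 2)
    + theta_res N \<tau> (int N - 2 * i) ((z + w + 1) / 2) * theta_res N \<tau> (- 2 * j) ((z - w) / 2)"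
proof -
  define t where "t k z n = ee (1/2 * of_nat N * (of_int n - of_int k / of_nat N + 1/2)\<^sup>2 * \<tau>
            + of_nat N * (of_int n - of_int k / of_nat N + 1/2) * (z + 1/2))" for k z and n :: int
  define h where "h r x n = ee ((of_int (2 * int N * n + r))\<^sup>2 * \<tau> / (4 * of_nat N) + of_int (2 * int N * n + r) * x)"
    for r x and n :: int
  define x y where "x = (z + w + 1) / 2" and "y = (z - w) / 2"
  define F where "F = (\<lambda>(n, m). t (i + j) z n * t (i - j) w m)"
  \<comment> \<open>These parametrise the pairs (n, m) with n + m odd and even: \<open>p1\<close>
    gives n + m + 1 = 2\<alpha> and n - m = 2\<beta> + 1, \<open>p2\<close> gives 2\<alpha> + 1 and
    2\<beta>.\<close>
  define p1 p2 where "p1 = (\<lambda>(\<alpha>, \<beta>). (\<alpha> + \<beta>, \<alpha> - \<beta> - 1 :: int))"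
    and "p2 = (\<lambda>(\<alpha>, \<beta>). (\<alpha> + \<beta>, \<alpha> - \<beta> :: int))"
  have sum_t: "(\<lambda>n. norm (t k z n)) summable_on UNIV" for k z
    unfolding t_def using assms by (rule theta_abs_summable)
  have sum_h: "(\<lambda>n. norm (h r x n)) summable_on UNIV" for r x
    unfolding h_def using assms by (rule theta_res_abs_summable)
  have F: "(F has_sum theta N (i + j) z \<tau> * theta N (i - j) w \<tau>) UNIV"
    using has_sum_Times_mult [OF sum_t [of "i + j" z] sum_t [of "i - j" w]]
    by (simp add: F_def theta_def t_def)
  \<comment> \<open>The identity a^2 + b^2 = ((a + b)^2 + (a - b)^2)/2, and its bilinear analogue
    for the linear terms, separate sum and difference.\<close>
  have uv: "ee (1/2 * of_nat N * a\<^sup>2 * \<tau> + of_nat N * a * (z + 1/2)) * ee (1/2 * of_nat N * b\<^sup>2 * \<tau> + of_nat N * b * (w + 1/2))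
      = ee (u\<^sup>2 * \<tau> / (4 * of_nat N) + u * x) * ee (v\<^sup>2 * \<tau> / (4 * of_nat N) + v * y)"
    if "u = of_nat N * (a + b)" "v = of_nat N * (a - b)" for a b u v
    unfolding that ee_add [symmetric] x_def y_def
    using assms by (intro arg_cong [where f = ee]) (simp add: field_simps power2_eq_square)
  have "F (p1 (\<alpha>, \<beta>)) = h (- 2 * i) x \<alpha> * h (int N - 2 * j) y \<beta>" for \<alpha> \<beta>
    unfolding F_def p1_def t_def h_def prod.case using assms
    by (intro uv) (simp_all add: field_simps)
  then have "F \<circ> p1 = (\<lambda>(\<alpha>, \<beta>). h (- 2 * i) x \<alpha> * h (int N - 2 * j) y \<beta>)"
    by auto
  then have "((F \<circ> p1) has_sum theta_res N \<tau> (- 2 * i) x * theta_res N \<tau> (int N - 2 * j) y) UNIV"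
    using has_sum_Times_mult [OF sum_h [of "- 2 * i" x] sum_h [of "int N - 2 * j" y]]
    by (simp add: theta_res_def h_def)
  then have 1: "(F has_sum theta_res N \<tau> (- 2 * i) x * theta_res N \<tau> (int N - 2 * j) y) (range p1)"
    by (subst has_sum_reindex) (auto simp: p1_def inj_on_def)
  have "F (p2 (\<alpha>, \<beta>)) = h (int N - 2 * i) x \<alpha> * h (- 2 * j) y \<beta>" for \<alpha> \<beta>
    unfolding F_def p2_def t_def h_def prod.case using assms
    by (intro uv) (simp_all add: field_simps)
  then have "F \<circ> p2 = (\<lambda>(\<alpha>, \<beta>). h (int N - 2 * i) x \<alpha> * h (- 2 * j) y \<beta>)"
    by auto
  then have "((F \<circ> p2) has_sum theta_res N \<tau> (int N - 2 * i) x * theta_res N \<tau> (- 2 * j) y) UNIV"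
    using has_sum_Times_mult [OF sum_h [of "int N - 2 * i" x] sum_h [of "- 2 * j" y]]
    by (simp add: theta_res_def h_def)
  then have 2: "(F has_sum theta_res N \<tau> (int N - 2 * i) x * theta_res N \<tau> (- 2 * j) y) (range p2)"
    by (subst has_sum_reindex) (auto simp: p2_def inj_on_def)
  have "range p1 \<inter> range p2 = {}"
  proof -
    have "\<alpha> - \<beta> - 1 \<noteq> \<gamma> - \<delta>" if "\<alpha> + \<beta> = \<gamma> + \<delta>" for \<alpha> \<beta> \<gamma> \<delta> :: int
      using that by presburger
    then show ?thesis by (auto simp: p1_def p2_def)
  qed
  moreover have "range p1 \<union> range p2 = UNIV"
  proof -
    have "(n, m) \<in> range p1 \<union> range p2" for n m
    proof (cases "even (n + m)")
      case True
      then have "(n, m) = p2 ((n + m) div 2, (n - m) div 2)"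
        unfolding p2_def prod.case prod.inject by presburger
      then show ?thesis by blast
    next
      case False
      then have "(n, m) = p1 ((n + m + 1) div 2, (n - m - 1) div 2)"
        unfolding p1_def prod.case prod.inject by presburger
      then show ?thesis by blast
    qed
    then show ?thesis by auto
  qed
  ultimately have "(F has_sum theta_res N \<tau> (- 2 * i) x * theta_res N \<tau> (int N - 2 * j) y
      + theta_res N \<tau> (int N - 2 * i) x * theta_res N \<tau> (- 2 * j) y) UNIV"
    using has_sum_Un_disjoint [OF 1 2] by simp
  with F show ?thesis
    unfolding x_def y_def by (rule has_sum_unique)
qed

text \<open>The linear relation between three vectors in a plane, with their 2 x 2 determinants as
  coefficients.\<close>

lemma theta_three_term:
  fixes z :: complex
  assumes "odd N" "Im \<tau> > 0"
  defines "a \<equiv> \<lambda>k. theta N k 0 \<tau>" and "f \<equiv> \<lambda>k. theta N k z \<tau> * theta N (- k) z \<tau>"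
  shows "a (i + j) * a (i - j) * f k + a (j + k) * a (j - k) * f i + a (k + i) * a (k - i) * f j = 0"
proof -
  have "N > 0" using assms by (auto intro: Nat.gr0I)
  define A B where "A k = theta_res N \<tau> (- 2 * k) 0" and "B k = theta_res N \<tau> (int N - 2 * k) 0" for k
  have "theta_res N \<tau> (- 2 * k) (1/2) = A k" "theta_res N \<tau> (int N - 2 * k) (1/2) = - B k" for k
    using theta_res_half [of N \<tau> "- k"] theta_res_half_odd [of "int N - 2 * k" N \<tau>] assms
    by (simp_all add: A_def B_def)
  then have a: "a (i + j) * a (i - j) = A i * B j - B i * A j" for i j
    unfolding a_def using theta_mult_theta [OF \<open>N > 0\<close> assms(2), of i j 0 0]
    by (simp add: A_def B_def)
  \<comment> \<open>Equal arguments make the difference argument 0, so k enters only through the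
    constants \<open>A k\<close> and \<open>B k\<close>.\<close>
  have f: "f k = theta_res N \<tau> 0 (z + 1/2) * B k + theta_res N \<tau> (int N) (z + 1/2) * A k" for k
    unfolding f_def using theta_mult_theta [OF \<open>N > 0\<close> assms(2), of 0 k z z]
    by (simp add: A_def B_def add_divide_distrib)
  show ?thesis
    unfolding a f by (simp add: algebra_simps)
qed

section \<open>Quadratic forms vanishing on the curve\<close>

lemma linear_psubst: "Vector_Spaces.linear psmult psmult (psubst f)"
proof -
  define g where "g m = (\<Prod>i\<in>Poly_Mapping.keys m. f i ^ Poly_Mapping.lookup m i)" for m
  \<comment> \<open>Cancellation can shrink the support of a sum, so the substitutions are compared
    over a common finite set of monomials.\<close>
  have psubst: "psubst f p = (\<Sum>m\<in>A. psmult (Poly_Mapping.lookup p m) (g m))"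
    if "finite A" "Poly_Mapping.keys p \<subseteq> A" for A p
    unfolding psubst_def g_def using that
    by (intro sum.mono_neutral_left) (auto simp: in_keys_iff)
  have "psubst f (p + q) = psubst f p + psubst f q" for p q
    using Poly_Mapping.keys_add [of p q]
    by (simp add: psubst [of "Poly_Mapping.keys p \<union> Poly_Mapping.keys q"] lookup_add
          cpoly.scale_left_distrib sum.distrib)
  moreover have "psubst f (psmult c p) = psmult c (psubst f p)" for c p
    unfolding psubst [OF finite_keys keys_psmult [of c p]] psubst [OF finite_keys order_refl, of p]
    by (simp add: lookup_psmult cpoly.scale_sum_right)
  ultimately show ?thesis
    by (simp add: Vector_Spaces.linear_iff cpoly.vector_space_axioms)
qed

lemma linear_shift: "Vector_Spaces.linear psmult psmult (shift N h)"
  by (simp add: shift_def linear_psubst)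

lemma peval_XX: "peval (X i * X j) x = x i * x j"
proof (cases "i = j")
  case True
  then show ?thesis
    by (simp add: peval_def XX_eq_single power2_eq_square flip: single_add numeral_2_eq_2)
next
  case False
  then have "Poly_Mapping.keys (Poly_Mapping.single i 1 + Poly_Mapping.single j (1::nat)) = {i, j}"
    by (auto simp: in_keys_iff lookup_add lookup_single when_def split: if_splits)
  then show ?thesis
    using False by (simp add: peval_def XX_eq_single lookup_add lookup_single)
qed

lemma lookup_XX:
  "Poly_Mapping.lookup (X p * X q) (Poly_Mapping.single r 1 + Poly_Mapping.single s 1) =
     (if p = r \<and> q = s \<or> p = s \<and> q = r then 1 else 0)"
proof -
  have "p = r \<and> q = s \<or> p = s \<and> q = r"
    if "Poly_Mapping.single p (1::nat) + Poly_Mapping.single q 1 = Poly_Mapping.single r 1 + Poly_Mapping.single s 1"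
  proof -
    have "Poly_Mapping.lookup (Poly_Mapping.single p (1::nat) + Poly_Mapping.single q 1) i =
        Poly_Mapping.lookup (Poly_Mapping.single r 1 + Poly_Mapping.single s 1) i" for i
      by (simp only: that)
    from this [of p] this [of q] this [of r] this [of s] show ?thesis
      by (simp add: lookup_add lookup_single when_def split: if_splits)
  qed
  then show ?thesis
    by (auto simp: XX_eq_single lookup_single when_def add.commute)
qed

lemma quadratic_forms_XX: "i < N \<Longrightarrow> j < N \<Longrightarrow> X i * X j \<in> quadratic_forms N"
proof (cases "i = j")
  case True
  then show "i < N \<Longrightarrow> j < N \<Longrightarrow> ?thesis"
    by (simp add: quadratic_forms_def XX_eq_single flip: single_add numeral_2_eq_2)
next
  case False
  then have "Poly_Mapping.keys (Poly_Mapping.single i 1 + Poly_Mapping.single j (1::nat)) = {i, j}"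
    by (auto simp: in_keys_iff lookup_add lookup_single when_def split: if_splits)
  then show "i < N \<Longrightarrow> j < N \<Longrightarrow> ?thesis"
    using False by (simp add: quadratic_forms_def XX_eq_single lookup_add lookup_single)
qed

section \<open>Forms of a fixed weight modulo N\<close>

definition weight_forms :: "nat \<Rightarrow> nat \<Rightarrow> cpoly set" where
  "weight_forms N k = cpoly.span {X i * X j | i j. i < N \<and> j < N \<and> [i + j = k] (mod N)}"

lemma weight_forms_XX: "i < N \<Longrightarrow> j < N \<Longrightarrow> [i + j = k] (mod N) \<Longrightarrow> X i * X j \<in> weight_forms N k"
  unfolding weight_forms_def by (rule cpoly.span_base) blast

text \<open>Reduces linear statements about evaluation and shifts to a single product
  \<open>X i * X j\<close>.\<close>

lemma weight_forms_induct [consumes 1, case_names zero step]: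
  assumes "p \<in> weight_forms N k"
    and "P 0"
    and "\<And>c i j q. i < N \<Longrightarrow> j < N \<Longrightarrow> [i + j = k] (mod N) \<Longrightarrow> P q \<Longrightarrow> P (psmult c (X i * X j) + q)"
  shows "P p"
  using assms(1) unfolding weight_forms_def
  by (induction rule: cpoly.span_induct_alt) (use assms(2,3) in auto)

lemma weight_forms_subset: "weight_forms N k \<subseteq> quadratic_forms N"
  unfolding weight_forms_def
proof (rule cpoly.span_minimal)
  show "cpoly.subspace (quadratic_forms N)"
  proof (rule cpoly.subspaceI)
    show "0 \<in> quadratic_forms N"
      by (simp add: quadratic_forms_def)
    show "p + q \<in> quadratic_forms N" if "p \<in> quadratic_forms N" "q \<in> quadratic_forms N" for p q
      using that Poly_Mapping.keys_add [of p q] unfolding quadratic_forms_def by blast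
    show "psmult c p \<in> quadratic_forms N" if "p \<in> quadratic_forms N" for c p
      using that keys_psmult [of c p] unfolding quadratic_forms_def by blast
  qed
qed (auto intro: quadratic_forms_XX)

lemma peval_weight_forms_scale:
  assumes "p \<in> weight_forms N k" "\<And>i. i < N \<Longrightarrow> x i = c * y i"
  shows "peval p x = c\<^sup>2 * peval p y"
  using assms(1)
proof (induction rule: weight_forms_induct)
  case (step d i j q)
  then show ?case
    by (simp add: peval_add peval_psmult peval_XX assms(2) power2_eq_square algebra_simps)
qed simp

text \<open>By homogeneity it is enough to test vanishing on one coordinate vector for each point of
  the curve.\<close>

lemma Vk_iff:
  "p \<in> Vk N \<tau> k \<longleftrightarrow> p \<in> weight_forms N k \<and> (\<forall>z. peval p (theta_vec N \<tau> z) = 0)"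
proof
  assume p: "p \<in> Vk N \<tau> k"
  have "theta_vec N \<tau> z \<in> proj_point (theta_vec N \<tau> z)" for z
    unfolding proj_point_def by (rule CollectI, rule exI [of _ 1]) simp
  then show "p \<in> weight_forms N k \<and> (\<forall>z. peval p (theta_vec N \<tau> z) = 0)"
    using p by (auto simp: Vk_def V_def weight_forms_def vanishes_on_def theta_curve_def)
next
  assume p: "p \<in> weight_forms N k \<and> (\<forall>z. peval p (theta_vec N \<tau> z) = 0)"
  then have "peval p (\<lambda>i. c * theta_vec N \<tau> z i) = 0" for c z
    using peval_weight_forms_scale [of p N k "\<lambda>i. c * theta_vec N \<tau> z i" c "theta_vec N \<tau> z"] by simp
  then show "p \<in> Vk N \<tau> k"
    using p subsetD [OF weight_forms_subset, of p N k]
    by (auto simp: Vk_def V_def weight_forms_def [symmetric] vanishes_on_def theta_curve_def proj_point_def)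
qed

section \<open>Cyclic shifts and the isomorphisms between the weight spaces\<close>

lemma shift_add: "shift N h (p + q) = shift N h p + shift N h q"
  and shift_psmult: "shift N h (psmult c p) = psmult c (shift N h p)"
  using linear_shift [of N h] by (simp_all add: Vector_Spaces.linear_iff)

lemma shift_0 [simp]: "shift N h 0 = 0"
  by (simp add: shift_def psubst_def)

lemma weight_forms_shift:
  assumes "p \<in> weight_forms N k" "[k + 2 * h = k'] (mod N)"
  shows "shift N h p \<in> weight_forms N k'"
  using assms(1)
proof (induction rule: weight_forms_induct)
  case zero
  then show ?case by (simp add: weight_forms_def cpoly.span_zero)
next
  case (step c i j q)
  have "[(i + h) mod N + (j + h) mod N = (i + h) + (j + h)] (mod N)"
    by (simp add: cong_def mod_add_eq)
  also have "(i + h) + (j + h) = (i + j) + 2 * h" by simp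
  also have "[(i + j) + 2 * h = k + 2 * h] (mod N)"
    using step by (intro cong_add) auto
  also note assms(2)
  finally have "X ((i + h) mod N) * X ((j + h) mod N) \<in> weight_forms N k'"
    using step by (intro weight_forms_XX) auto
  then show ?case
    using step unfolding shift_add shift_psmult shift_XX weight_forms_def
    by (intro cpoly.span_add cpoly.span_scale) auto
qed

lemma peval_shift:
  assumes "p \<in> weight_forms N k"
  shows "peval (shift N h p) x = peval p (\<lambda>i. x ((i + h) mod N))"
  using assms
  by (induction rule: weight_forms_induct)
     (simp_all add: shift_add shift_psmult shift_XX peval_add peval_psmult peval_XX)

lemma shift_shift:
  assumes "p \<in> weight_forms N k" "[h + h' = 0] (mod N)"
  shows "shift N h' (shift N h p) = p"
  using assms(1)
proof (induction rule: weight_forms_induct)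
  case (step c i j q)
  have "((i + h) mod N + h') mod N = i" if "i < N" for i
  proof -
    have "((i + h) mod N + h') mod N = (i + (h + h') mod N) mod N"
      by (simp add: mod_simps algebra_simps)
    then show ?thesis using that assms(2) by (simp add: cong_def)
  qed
  then show ?case
    using step by (simp add: shift_add shift_psmult shift_XX)
qed simp

text \<open>The cyclically shifted coordinates at z are a common multiple of those at z - h\<tau>/N,
  again a point of the curve, where p vanishes. Each index grows by h, hence the weight by
  2h.\<close>

lemma Vk_shift:
  assumes "p \<in> Vk N \<tau> k" "[k + 2 * h = k'] (mod N)" "N > 0"
  shows "shift N h p \<in> Vk N \<tau> k'"
proof -
  have p: "p \<in> weight_forms N k" "\<And>z. peval p (theta_vec N \<tau> z) = 0"
    using assms(1) by (auto simp: Vk_iff)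
  have "peval (shift N h p) (theta_vec N \<tau> z) = 0" for z
  proof -
    have "theta_vec N \<tau> z ((i + h) mod N) =
        ee ((of_int (int h))\<^sup>2 * \<tau> / (2 * of_nat N) - of_int (int h) * (z + 1/2)) *
        theta_vec N \<tau> (z - of_int (int h) * \<tau> / of_nat N) i" if "i < N" for i
    proof -
      have "theta_vec N \<tau> z ((i + h) mod N) = theta N (int i + int h) z \<tau>"
        using assms(3) by (auto simp: theta_vec_def cong_def zmod_int intro!: theta_cong)
      then show ?thesis
        using that unfolding theta_translate [OF assms(3)] by (simp add: theta_vec_def)
    qed
    then show ?thesis
      using peval_weight_forms_scale [OF p(1)] p(2) by (simp add: peval_shift [OF p(1)])
  qed
  then show ?thesis
    using weight_forms_shift [OF p(1) assms(2)] by (simp add: Vk_iff)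
qed

text \<open>The shift by N - h inverts the shift by h, and twice the half of k is k modulo
  N.\<close>

lemma bij_betw_shift:
  assumes "odd N"
  shows "bij_betw (shift N (half_mod N k)) (Vk N \<tau> 0) (Vk N \<tau> k)"
proof -
  define h where "h = half_mod N k"
  have N: "N > 0" using assms by (auto intro: Nat.gr0I)
  then have "h < N" by (simp add: h_def half_mod_def)
  then have h': "h + (N - h) = N" by simp
  have hk: "[2 * h = k] (mod N)"
    unfolding h_def by (rule half_mod_cong [OF assms])
  have "[k + 2 * (N - h) = 2 * h + 2 * (N - h)] (mod N)"
    using hk by (intro cong_add) (auto simp: cong_sym)
  also have "2 * h + 2 * (N - h) = 2 * N"
    using h' by simp
  finally have hk': "[k + 2 * (N - h) = 0] (mod N)"
    by (simp add: cong_def)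
  show ?thesis
    unfolding h_def [symmetric]
  proof (rule bij_betw_byWitness [of _ "shift N (N - h)"])
    show "\<forall>p\<in>Vk N \<tau> 0. shift N (N - h) (shift N h p) = p"
      using h' by (auto simp: Vk_iff cong_def intro!: shift_shift)
    show "\<forall>p\<in>Vk N \<tau> k. shift N h (shift N (N - h) p) = p"
      using h' by (auto simp: Vk_iff cong_def add.commute intro!: shift_shift)
    show "shift N h ` Vk N \<tau> 0 \<subseteq> Vk N \<tau> k"
      using Vk_shift [OF _ _ N, of _ \<tau> 0 h k] hk by auto
    show "shift N (N - h) ` Vk N \<tau> k \<subseteq> Vk N \<tau> 0"
      using Vk_shift [OF _ hk' N] by auto
  qed
qed

section \<open>The basis of V_0, for N = 2h + 1\<close>

context
  fixes N h :: nat and \<tau> :: complex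
  assumes N: "N = 2 * h + 1" and h: "h \<ge> 2" and tau: "Im \<tau> > 0"
begin

lemma theta_quadric_eq:
  "theta_quadric N \<tau> j =
     psmult (theta_null N \<tau> (j + 1) * theta_null N \<tau> (N - j)) (X 0 * X 0)
     - psmult (theta_null N \<tau> (h - j) * theta_null N \<tau> (h + 1 + j)) (X (h + 1) * X h)
     + psmult (theta_null N \<tau> h * theta_null N \<tau> (h + 1)) (X (h - j) * X (h + 1 + j))"
proof -
  have "(N + 1) div 2 = h + 1" "(N - 1) div 2 = h" using N by auto
  then show ?thesis
    by (simp only: theta_quadric_def Let_def power2_eq_square)
qed

lemma theta_null_nonzero: "0 < i \<Longrightarrow> i < N \<Longrightarrow> theta_null N \<tau> i \<noteq> 0"
  unfolding theta_null_def using tau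
  by (intro theta_zero_nonzero) (auto simp: nat_dvd_not_less)

lemma theta_quadric_mem:
  assumes "j \<in> {1..h - 1}"
  shows "theta_quadric N \<tau> j \<in> Vk N \<tau> 0"
proof -
  have "theta_quadric N \<tau> j \<in> weight_forms N 0"
  proof -
    have "X 0 * X 0 \<in> weight_forms N 0" "X (h + 1) * X h \<in> weight_forms N 0"
        "X (h - j) * X (h + 1 + j) \<in> weight_forms N 0"
    proof -
      have "h + 1 + h = N" "h - j + (h + 1 + j) = N" "0 < N" "h + 1 < N" "h + 1 + j < N"
        using N h assms by auto
      then show "X 0 * X 0 \<in> weight_forms N 0" "X (h + 1) * X h \<in> weight_forms N 0"
          "X (h - j) * X (h + 1 + j) \<in> weight_forms N 0"
        by (intro weight_forms_XX; simp add: cong_def)+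
    qed
    then show ?thesis
      unfolding theta_quadric_eq weight_forms_def
      by (intro cpoly.span_add cpoly.span_diff cpoly.span_scale)
  qed
  moreover have "peval (theta_quadric N \<tau> j) (theta_vec N \<tau> z) = 0" for z
  proof -
    define a where "a k = theta N k 0 \<tau>" for k
    define t where "t k = theta N k z \<tau>" for k
    have "odd N" "N > 0" using N by auto
    \<comment> \<open>Thetanulls are odd in the index, by \<open>theta_uminus\<close> at z = 0. For
      general z the sign change of the index also moves z, so \<open>t_neg\<close> below uses
      periodicity only.\<close>
    have a_neg: "a k = - a k'" if "[k + k' = 0] (mod int N)" for k k'
    proof -
      have "[k = - k'] (mod int N)"
        using that by (simp add: cong_iff_dvd_diff)
      then have "a k = a (- k')"
        unfolding a_def using \<open>N > 0\<close> by (intro theta_cong)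
      then show ?thesis
        using theta_uminus [OF \<open>odd N\<close>, of k' 0 \<tau>] by (simp add: a_def)
    qed
    have t_neg: "t (- k) = t k'" if "[k + k' = 0] (mod int N)" for k k'
    proof -
      have "[- k = k'] (mod int N)"
        using that by (simp add: cong_iff_dvd_diff dvd_diff_commute add.commute)
      then show ?thesis
        unfolding t_def using \<open>N > 0\<close> by (intro theta_cong)
    qed
    have quad: "peval (psmult c p - psmult d q + psmult e r) x = c * peval p x - d * peval q x + e * peval r x" for c d e p q r x
    proof -
      have "psmult c p - psmult d q + psmult e r = psmult c p + psmult (- d) q + psmult e r"
        by simp
      then show ?thesis
        by (simp only: peval_add peval_psmult) simp
    qed
    have "peval (theta_quadric N \<tau> j) (theta_vec N \<tau> z) =
        a (int j + 1) * a (int N - int j) * (t 0 * t 0)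
        - a (int h - int j) * a (int h + 1 + int j) * (t (int h + 1) * t (int h))
        + a (int h) * a (int h + 1) * (t (int h - int j) * t (int h + 1 + int j))"
    proof -
      have v: "theta_vec N \<tau> z i = t (int i)" if "i < N" for i
        using that by (simp add: theta_vec_def t_def)
      have null: "theta_null N \<tau> i = a (int i)" for i
        by (simp add: theta_null_def a_def)
      have "0 < N" "h < N" "h + 1 < N" "h - j < N" "h + 1 + j < N" "j \<le> h" "j \<le> N"
        using N h assms by auto
      then show ?thesis
        unfolding theta_quadric_eq quad peval_XX null by (simp add: v of_nat_diff add_ac)
    qed
    \<comment> \<open>Indices are replaced modulo 2h + 1 to reach the shape of the three-term
      relation for 0, h and h - j. Two signs cancel in the first coefficient; in the second, one
      sign turns the minus into a plus.\<close>
    also have "\<dots> = a (2 * int h - int j) * a (int j) * (t 0 * t (- 0))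
        + a (int h - int j) * a (int h - int j) * (t (int h) * t (- int h))
        + a (int h) * a (- int h) * (t (int h - int j) * t (- (int h - int j)))"
    proof -
      have "a (int j + 1) = - a (2 * int h - int j)" "a (int N - int j) = - a (int j)"
          "a (int h + 1 + int j) = - a (int h - int j)"
        using N by (auto intro!: a_neg simp: cong_def add.commute)
      moreover have "a (int h + 1) = a (- int h)"
        using N \<open>N > 0\<close> unfolding a_def by (intro theta_cong) (auto simp: cong_iff_dvd_diff add.commute)
      moreover have "t (- (int h - int j)) = t (int h + 1 + int j)" "t (- int h) = t (int h + 1)"
        by (rule t_neg, simp add: N cong_def add.commute)+
      ultimately show ?thesis
        by (simp add: algebra_simps)
    qed
    also have "\<dots> = 0"
      using theta_three_term [OF \<open>odd N\<close> tau, of 0 "int h" "int h - int j" z]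
      by (simp add: a_def t_def algebra_simps)
    finally show ?thesis .
  qed
  ultimately show ?thesis
    by (simp add: Vk_iff)
qed

text \<open>Each quadric has a monomial of its own: for k >= 1 the product of
  \<open>X (h - k)\<close> and \<open>X (h + 1 + k)\<close> differs from the two monomials common to
  all quadrics. Injectivity and independence follow by reading off this coefficient.\<close>

lemma lookup_theta_quadric:
  assumes "j \<in> {1..h - 1}" "k \<in> {1..h - 1}"
  shows "Poly_Mapping.lookup (theta_quadric N \<tau> j) (Poly_Mapping.single (h - k) 1 + Poly_Mapping.single (h + 1 + k) 1)
    = (if j = k then theta_null N \<tau> h * theta_null N \<tau> (h + 1) else 0)"
  using assms h unfolding theta_quadric_eq
  by (auto simp: lookup_add lookup_minus lookup_psmult lookup_XX simp del: One_nat_def)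

lemma theta_null_mid_nonzero: "theta_null N \<tau> h * theta_null N \<tau> (h + 1) \<noteq> 0"
  using theta_null_nonzero [of h] theta_null_nonzero [of "h + 1"] N h by simp

lemma inj_on_theta_quadric: "inj_on (theta_quadric N \<tau>) {1..h - 1}"
proof (rule inj_onI)
  fix j k assume "j \<in> {1..h - 1}" "k \<in> {1..h - 1}" "theta_quadric N \<tau> j = theta_quadric N \<tau> k"
  then show "j = k"
    using lookup_theta_quadric [of j k] lookup_theta_quadric [of k k] theta_null_mid_nonzero
    by (metis (full_types))
qed

lemma independent_theta_quadric: "cpoly.independent (theta_quadric N \<tau> ` {1..h - 1})"
  unfolding cpoly.dependent_def
proof clarify
  fix j assume j: "j \<in> {1..h - 1}"
    "theta_quadric N \<tau> j \<in> cpoly.span (theta_quadric N \<tau> ` {1..h - 1} - {theta_quadric N \<tau> j})"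
  define m where "m = Poly_Mapping.single (h - j) 1 + Poly_Mapping.single (h + 1 + j) (1 :: nat)"
  have "cpoly.subspace {p. Poly_Mapping.lookup p m = 0}"
    by (rule cpoly.subspaceI) (auto simp: lookup_add lookup_psmult)
  moreover have "theta_quadric N \<tau> ` {1..h - 1} - {theta_quadric N \<tau> j} \<subseteq> {p. Poly_Mapping.lookup p m = 0}"
    using lookup_theta_quadric [OF _ j(1)] by (auto simp: m_def)
  ultimately have "Poly_Mapping.lookup (theta_quadric N \<tau> j) m = 0"
    using cpoly.span_minimal j(2) by blast
  then show False
    using lookup_theta_quadric [OF j(1) j(1)] theta_null_mid_nonzero by (simp add: m_def)
qed

lemma span_theta_quadric: "cpoly.span (theta_quadric N \<tau> ` {1..h - 1}) = Vk N \<tau> 0"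
proof
  define Q where "Q = theta_quadric N \<tau> ` {1..h - 1}"
  have QV: "cpoly.span Q \<subseteq> Vk N \<tau> 0"
    unfolding Q_def using theta_quadric_mem by (intro cpoly.span_minimal subspace_Vk) blast
  then show "cpoly.span (theta_quadric N \<tau> ` {1..h - 1}) \<subseteq> Vk N \<tau> 0"
    by (simp add: Q_def)
  \<comment> \<open>Two monomials added to the quadrics suffice to span all forms of weight 0: each
    quadric can be solved for its own monomial, since a_h a_(h+1) is nonzero.\<close>
  define B where "B = insert (X 0 * X 0) (insert (X (h + 1) * X h) Q)"
  have mid: "X (h - j) * X (h + 1 + j) \<in> cpoly.span B" if "j \<in> {1..h - 1}" for j
  proof -
    define c where "c = theta_null N \<tau> h * theta_null N \<tau> (h + 1)"
    have "psmult c (X (h - j) * X (h + 1 + j)) = theta_quadric N \<tau> j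
      - psmult (theta_null N \<tau> (j + 1) * theta_null N \<tau> (N - j)) (X 0 * X 0)
      + psmult (theta_null N \<tau> (h - j) * theta_null N \<tau> (h + 1 + j)) (X (h + 1) * X h)"
      unfolding theta_quadric_eq c_def by simp
    also have "\<dots> \<in> cpoly.span B"
      using that by (intro cpoly.span_add cpoly.span_diff cpoly.span_scale cpoly.span_base)
        (auto simp: B_def Q_def)
    finally have "psmult (inverse c) (psmult c (X (h - j) * X (h + 1 + j))) \<in> cpoly.span B"
      by (rule cpoly.span_scale)
    moreover have "c \<noteq> 0"
      using theta_null_mid_nonzero by (simp add: c_def)
    ultimately show ?thesis by simp
  qed
  have lower: "X i * X (N - i) \<in> cpoly.span B" if "1 \<le> i" "i \<le> h" for i
  proof (cases "i = h")
    case True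
    then show ?thesis
      using N by (auto intro!: cpoly.span_base simp: B_def mult.commute)
  next
    case False
    have "h - (h - i) = i" "h + 1 + (h - i) = N - i"
      using that N by auto
    moreover have "h - i \<in> {1..h - 1}"
      using that False by auto
    ultimately show ?thesis
      using mid [of "h - i"] by simp
  qed
  have "{X i * X j | i j. i < N \<and> j < N \<and> [i + j = 0] (mod N)} \<subseteq> cpoly.span B"
  proof clarify
    fix i j assume ij: "i < N" "j < N" "[i + j = 0] (mod N)"
    then obtain d where d: "i + j = N * d"
      by (auto simp: cong_0_iff)
    have "N * d < N * 2" using ij d by linarith
    \<comment> \<open>As i + j < 2N, either both indices are 0, or they add up to N and one of them
      is at most h.\<close>
    then have "d = 0 \<or> d = 1" by auto
    then consider "i = 0" "j = 0" | "1 \<le> i" "i \<le> h" "j = N - i" | "1 \<le> j" "j \<le> h" "i = N - j"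
      using ij d N by fastforce
    then show "X i * X j \<in> cpoly.span B"
    proof cases
      case 1
      then show ?thesis by (auto intro!: cpoly.span_base simp: B_def)
    next
      case 2
      then show ?thesis using lower by simp
    next
      case 3
      then show ?thesis using lower by (simp add: mult.commute)
    qed
  qed
  then have weight_B: "weight_forms N 0 \<subseteq> cpoly.span B"
    unfolding weight_forms_def by (rule cpoly.span_minimal) simp
  show "Vk N \<tau> 0 \<subseteq> cpoly.span (theta_quadric N \<tau> ` {1..h - 1})"
  proof
    fix p assume p: "p \<in> Vk N \<tau> 0"
    then have "p \<in> cpoly.span B"
      using weight_B by (auto simp: Vk_iff)
    then obtain \<alpha> \<beta> where r: "p - psmult \<alpha> (X 0 * X 0) - psmult \<beta> (X (h + 1) * X h) \<in> cpoly.span Q"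
      unfolding B_def cpoly.span_breakdown_eq by blast
    define r where "r = p - psmult \<alpha> (X 0 * X 0) - psmult \<beta> (X (h + 1) * X h)"
    have "r \<in> Vk N \<tau> 0"
      using r QV by (auto simp: r_def)
    have "p = r + psmult \<alpha> (X 0 * X 0) + psmult \<beta> (X (h + 1) * X h)"
      by (simp add: r_def)
    then have "peval p x = peval r x + \<alpha> * (x 0 * x 0) + \<beta> * (x (h + 1) * x h)" for x
      by (simp only: peval_add peval_psmult peval_XX)
    then have rel: "\<alpha> * (theta N 0 z \<tau> * theta N 0 z \<tau>) + \<beta> * (theta N (int (h + 1)) z \<tau> * theta N (int h) z \<tau>) = 0" for z
      using p \<open>r \<in> Vk N \<tau> 0\<close> N h by (simp add: Vk_iff theta_vec_def)
    have "odd N" "N > 0" using N by auto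
    \<comment> \<open>Evaluation at z = 0 removes the \<alpha> term, since theta_0 is odd, and
      leaves \<beta> times a nonzero product of thetanulls.\<close>
    have "theta N 0 0 \<tau> = 0"
      using theta_uminus [OF \<open>odd N\<close>, of 0 0 \<tau>] by simp
    then have "\<beta> = 0"
      using rel [of 0] theta_null_mid_nonzero by (simp add: theta_null_def)
    \<comment> \<open>A point where theta_0 is nonzero: translation makes a_h an exponential
      multiple of its value at -h\<tau>/N.\<close>
    moreover have "theta N 0 (0 - of_int (int h) * \<tau> / of_nat N) \<tau> \<noteq> 0"
      using theta_translate [OF \<open>N > 0\<close>, of 0 "int h" 0 \<tau>] theta_null_nonzero [of h] N h
      by (auto simp: theta_null_def)
    then have "\<alpha> = 0"
      using rel [of "0 - of_int (int h) * \<tau> / of_nat N"] \<open>\<beta> = 0\<close> by simp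
    ultimately show "p \<in> cpoly.span (theta_quadric N \<tau> ` {1..h - 1})"
      using r by (simp add: Q_def)
  qed
qed

end

theorem theorem6p4:
  fixes N :: nat and \<tau> :: complex
  assumes "N \<ge> 5" and "odd N" and "Im \<tau> > 0"
  shows "(\<forall>k<N. Vector_Spaces.linear psmult psmult (shift N (half_mod N k)) \<and>
                bij_betw (shift N (half_mod N k)) (Vk N \<tau> 0) (Vk N \<tau> k)) \<and>
         (inj_on (theta_quadric N \<tau>) {1..(N - 3) div 2} \<and>
          cpoly.independent (theta_quadric N \<tau> ` {1..(N - 3) div 2}) \<and>
          cpoly.span (theta_quadric N \<tau> ` {1..(N - 3) div 2}) = Vk N \<tau> 0)"
proof -
  obtain h where h: "N = 2 * h + 1"
    using assms(2) by (elim oddE)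
  then have "2 \<le> h" "(N - 3) div 2 = h - 1"
    using assms(1) by auto
  then show ?thesis
    using linear_shift bij_betw_shift [OF assms(2)] inj_on_theta_quadric [OF h _ assms(3)]
      independent_theta_quadric [OF h _ assms(3)] span_theta_quadric [OF h _ assms(3)] by simp
qed

end
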